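(* Let $m\ge2$ be an integer and let $p_1,\ldots,p_m\ge0$ with $p_1+\cdots+p_m=1$. Let $R=(R_n)_{n\in\mathbb{N}}$ be the random walk on $\mathbb{N}^m$ with $R_0=0$ and i.i.d. increments equal to $e_\ell$ with probability $p_\ell$, $\ell=1,\ldots,m$, and let $\tilde R_n:=R_n-\frac{n}{m}(1,\ldots,1)$ for $n\in\mathbb{N}$. If $p_j\ne\frac1m$ for at least one $j\in\{1,\ldots,m\}$, then the point $0$ (and therefore the random walk $\tilde R$) is transient. If $p_j=\frac1m$ for all $j\in\{1,\ldots,m\}$, then the point $0$ (and therefore the random walk $\tilde R$) is recurrent for $m\le3$ and transient for $m\ge4$.
   Context: $\mathbb{N}=\{0,1,2,\ldots\}$ and $e_\ell\in\mathbb{N}^m$ is the $\ell$-th canonical basis vector. $\tilde R$ is a random walk on the lattice generated by the vectors $e_1-\frac1m(1,\ldots,1),\ldots,e_m-\frac1m(1,\ldots,1)$, which span an $(m-1)$-dimensional hyperplane of $\mathbb{R}^m$. Recurrence and transience of a state are meant in the usual sense for Markov chains. *)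

theory Defs
  imports "HOL-Probability.Probability"
begin

text \<open>A time-homogeneous Markov chain \<^term>\<open>Y\<close> with countable state space \<^term>\<open>S\<close> and
  transition kernel \<^term>\<open>K\<close>.  The Markov property is written in product form, so that no
  conditioning on null events is needed.\<close>

definition markov_chain ::
    "'s set \<Rightarrow> ('s \<Rightarrow> 's pmf) \<Rightarrow> 'w measure \<Rightarrow> (nat \<Rightarrow> 'w \<Rightarrow> 's) \<Rightarrow> bool" where
  "markov_chain S K M Y \<longleftrightarrow>
     countable S \<and> (\<forall>x\<in>S. set_pmf (K x) \<subseteq> S) \<and> prob_space M \<and>
     (\<forall>n. Y n \<in> measurable M (count_space UNIV)) \<and>
     (\<forall>n. AE \<omega> in M. Y n \<omega> \<in> S) \<and>
     (\<forall>n y. measure M {\<omega> \<in> space M. \<forall>i\<le>Suc n. Y i \<omega> = y i} =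
            measure M {\<omega> \<in> space M. \<forall>i\<le>n. Y i \<omega> = y i} * pmf (K (y n)) (y (Suc n)))"

text \<open>The law \<open>P\<^sub>x\<close>, on the space of trajectories, of the chain with kernel \<^term>\<open>K\<close>
  started at \<^term>\<open>x\<close>; see \<open>markov_chain_path_measure\<close> and \<open>path_measure_start\<close>
  below.\<close>

definition path_step :: "('s \<Rightarrow> 's pmf) \<Rightarrow> 's \<Rightarrow> nat \<Rightarrow> (nat \<Rightarrow> 's) \<Rightarrow> 's measure" where
  "path_step K x i \<omega> = measure_pmf (if i = 0 then return_pmf x else K (\<omega> (i - 1)))"

definition path_measure :: "('s \<Rightarrow> 's pmf) \<Rightarrow> 's \<Rightarrow> (nat \<Rightarrow> 's) measure" where
  "path_measure K x =
     projective_family.lim UNIV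
       (Ionescu_Tulcea.CI (path_step K x) (\<lambda>_. count_space UNIV)) (\<lambda>_. count_space UNIV)"

definition return_probability :: "('s \<Rightarrow> 's pmf) \<Rightarrow> 's \<Rightarrow> real" where
  "return_probability K x =
     measure (path_measure K x) {X \<in> space (path_measure K x). \<exists>n\<ge>1. X n = x}"

definition recurrent_state :: "('s \<Rightarrow> 's pmf) \<Rightarrow> 's \<Rightarrow> bool" where
  "recurrent_state K x \<longleftrightarrow> return_probability K x = 1"

definition transient_state :: "('s \<Rightarrow> 's pmf) \<Rightarrow> 's \<Rightarrow> bool" where
  "transient_state K x \<longleftrightarrow> return_probability K x < 1"

definition recurrent_chain :: "'s set \<Rightarrow> ('s \<Rightarrow> 's pmf) \<Rightarrow> bool" where
  "recurrent_chain S K \<longleftrightarrow> (\<forall>x\<in>S. recurrent_state K x)"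

definition transient_chain :: "'s set \<Rightarrow> ('s \<Rightarrow> 's pmf) \<Rightarrow> bool" where
  "transient_chain S K \<longleftrightarrow> (\<forall>x\<in>S. transient_state K x)"

lemma Ionescu_Tulcea_path_step:
  "Ionescu_Tulcea (path_step K x) (\<lambda>_. count_space UNIV)"
proof (rule Ionescu_Tulcea.intro)
  fix i
  show "path_step K x i \<in> measurable (PiM {0..<i} (\<lambda>_. count_space UNIV))
          (subprob_algebra (count_space UNIV))"
  proof (cases "i = 0")
    case True
    then show ?thesis
      by (simp add: path_step_def[abs_def] measure_pmf_in_subprob_algebra)
  next
    case False
    have *: "(\<lambda>y. measure_pmf (K y)) \<in> measurable (count_space UNIV) (subprob_algebra (count_space UNIV))"
      by (simp add: measure_pmf_in_subprob_algebra)
    have "(\<lambda>\<omega>. \<omega> (i - 1)) \<in> measurable (PiM {0..<i} (\<lambda>_. count_space UNIV)) (count_space UNIV)"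
      using False by (intro measurable_component_singleton) auto
    from measurable_compose[OF this *] False show ?thesis
      by (simp add: path_step_def[abs_def])
  qed
qed (simp add: path_step_def prob_space_measure_pmf)

context
  fixes K :: "'s \<Rightarrow> 's pmf" and x :: 's
begin

interpretation IT: Ionescu_Tulcea "path_step K x" "\<lambda>_. count_space UNIV"
  by (rule Ionescu_Tulcea_path_step)

lemma path_measure_eq: "path_measure K x = IT.PF.lim"
  by (simp add: path_measure_def)

lemma sets_path_measure [measurable_cong]:
  "sets (path_measure K x) = sets (PiM UNIV (\<lambda>_. count_space UNIV))"
  by (simp add: path_measure_eq)

lemma space_path_measure [simp]: "space (path_measure K x) = UNIV"
  by (simp add: path_measure_eq space_PiM)

lemma prob_space_path_measure: "prob_space (path_measure K x)"
proof (rule prob_space_distrD)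
  show "(\<lambda>X. restrict X {0..<0}) \<in> measurable (path_measure K x)
          (PiM {0..<0::nat} (\<lambda>_. count_space UNIV))"
    by (intro measurable_restrict_subset[THEN measurable_cong_sets[OF sets_path_measure refl, THEN equalityD2, THEN subsetD]]) simp
  show "prob_space (distr (path_measure K x) (PiM {0..<0::nat} (\<lambda>_. count_space UNIV))
          (\<lambda>X. restrict X {0..<0}))"
    unfolding path_measure_eq by (subst IT.distr_lim) (auto intro: IT.PF.prob_space_P)
qed

lemma measurable_path_measure [measurable]:
  "(\<lambda>X. X n) \<in> measurable (path_measure K x) (count_space UNIV)"
  using measurable_component_singleton[of n UNIV "\<lambda>_. count_space (UNIV :: 's set)"]
  by (simp cong: measurable_cong_sets add: sets_path_measure)

lemma sets_singleton_path:
  "{restrict y {0..<k}} \<in> sets (PiM {0..<k} (\<lambda>_::nat. count_space (UNIV :: 's set)))"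
proof -
  have "{restrict y {0..<k}} = PiE {0..<k} (\<lambda>i. {y i})"
    by (subst PiE_singleton[of "restrict y {0..<k}" "{0..<k}", symmetric]) (auto intro!: PiE_cong)
  also have "\<dots> \<in> sets (PiM {0..<k} (\<lambda>_::nat. count_space (UNIV :: 's set)))"
    by (intro sets_PiM_I_finite) auto
  finally show ?thesis .
qed

lemma emeasure_C_singleton:
  "emeasure (IT.C 0 n (\<lambda>_. undefined)) {restrict y {0..<n}} =
     (\<Prod>i<n. emeasure (path_step K x i (restrict y {0..<i})) {y i})"
proof (induction n)
  case 0
  have "(\<lambda>_. undefined) \<in> space (PiM {} (\<lambda>_. count_space (UNIV::'s set)))"
    by (simp add: space_PiM)
  then show ?case
    by (simp add: space_PiM PiM_empty)
next
  case (Suc n)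
  let ?u = "\<lambda>_::nat. undefined :: 's"
  let ?N = "\<lambda>n. PiM {0..<n} (\<lambda>_::nat. count_space (UNIV :: 's set))"
  have u: "?u \<in> space (?N 0)" by (simp add: space_PiM)
  note sing = sets_singleton_path
  have sC: "space (IT.C 0 n ?u) = space (?N n)"
    using IT.space_C[OF u, of n] by simp
  have setsC: "sets (IT.C 0 n ?u) = sets (?N n)"
    using IT.sets_C[OF u, of n] by simp
  have "emeasure (IT.C 0 (Suc n) ?u) {restrict y {0..<Suc n}} =
        (\<integral>\<^sup>+\<omega>. emeasure (IT.eP n \<omega>) {restrict y {0..<Suc n}} \<partial>IT.C 0 n ?u)"
    using IT.measurable_eP[of n] sing[of y "Suc n"] u
    by (simp, subst emeasure_bind[where N="?N (Suc n)"])
       (auto simp: sC space_PiM PiE_eq_empty_iff setsC cong: measurable_cong_sets)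
  also have "\<dots> = (\<integral>\<^sup>+\<omega>. emeasure (path_step K x n (restrict y {0..<n})) {y n} *
                     indicator {restrict y {0..<n}} \<omega> \<partial>IT.C 0 n ?u)"
  proof (rule nn_integral_cong)
    fix \<omega> assume "\<omega> \<in> space (IT.C 0 n ?u)"
    then have w: "\<omega> \<in> space (?N n)" by (simp add: sC)
    have ext: "\<omega> \<in> extensional {0..<n}" using w by (auto simp: space_PiM PiE_def)
    have "fun_upd \<omega> n -` {restrict y {0..<Suc n}} =
          (if \<omega> = restrict y {0..<n} then {y n} else {})"
    proof -
      have "fun_upd \<omega> n z = restrict y {0..<Suc n} \<longleftrightarrow> \<omega> = restrict y {0..<n} \<and> z = y n" for z
      proof
        assume a: "fun_upd \<omega> n z = restrict y {0..<Suc n}"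
        have "z = y n" using fun_cong[OF a, of n] by simp
        moreover have "\<omega> i = restrict y {0..<n} i" for i
        proof (cases "i < n")
          case True then show ?thesis using fun_cong[OF a, of i] by simp
        next
          case False then show ?thesis using ext by (simp add: extensional_def)
        qed
        ultimately show "\<omega> = restrict y {0..<n} \<and> z = y n" by auto
      next
        assume "\<omega> = restrict y {0..<n} \<and> z = y n"
        then show "fun_upd \<omega> n z = restrict y {0..<Suc n}"
          by (auto simp: fun_eq_iff)
      qed
      then show ?thesis by auto
    qed
    then show "emeasure (IT.eP n \<omega>) {restrict y {0..<Suc n}} =
       emeasure (path_step K x n (restrict y {0..<n})) {y n} * indicator {restrict y {0..<n}} \<omega>"
      using IT.emeasure_eP[OF w sing[of y "Suc n"]] by (auto split: if_splits)
  qed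
  also have "\<dots> = emeasure (path_step K x n (restrict y {0..<n})) {y n} *
                  emeasure (IT.C 0 n ?u) {restrict y {0..<n}}"
    using sing[of y n] by (intro nn_integral_cmult_indicator) (simp add: setsC)
  finally show ?case
    unfolding Suc.IH prod.lessThan_Suc by (simp only: mult.commute)
qed

lemma measure_path_measure_cylinder:
  "measure (path_measure K x) {X. \<forall>i\<le>n. X i = y i} =
     (if y 0 = x then 1 else 0) * (\<Prod>i<n. pmf (K (y i)) (y (Suc i)))"
proof -
  let ?N = "PiM {0..<Suc n} (\<lambda>_::nat. count_space (UNIV :: 's set))"
  note sing = sets_singleton_path
  have "{X. \<forall>i\<le>n. X i = y i} = IT.PF.emb UNIV {0..<Suc n} {restrict y {0..<Suc n}}"
    by (force simp: prod_emb_def space_PiM fun_eq_iff restrict_def less_Suc_eq_le split: if_splits)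
  then have "emeasure (path_measure K x) {X. \<forall>i\<le>n. X i = y i} =
      emeasure (IT.CI {0..<Suc n}) {restrict y {0..<Suc n}}"
    unfolding path_measure_eq by (simp only: IT.lim[OF finite_atLeastLessThan sing])
  also have "\<dots> = emeasure (IT.C 0 (Suc n) (\<lambda>_. undefined))
                     (IT.PF.emb {0..<Suc n} {0..<Suc n} {restrict y {0..<Suc n}})"
    by (rule IT.emeasure_CI[OF subset_refl sing])
  also have "IT.PF.emb {0..<Suc n} {0..<Suc n} {restrict y {0..<Suc n}} =
      {restrict y {0..<Suc n}}"
    by (rule prod_emb_id) (simp add: PiE_def)
  also note emeasure_C_singleton
  also have "(\<Prod>i<Suc n. emeasure (path_step K x i (restrict y {0..<i})) {y i}) =
      ennreal ((if y 0 = x then 1 else 0) * (\<Prod>i<n. pmf (K (y i)) (y (Suc i))))"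
    by (subst prod.lessThan_Suc_shift)
       (auto simp: path_step_def emeasure_pmf_single prod_ennreal)
  finally show ?thesis
    by (simp add: measure_def prod_nonneg)
qed

lemma path_measure_start: "AE X in path_measure K x. X 0 = x"
proof -
  interpret prob_space "path_measure K x" by (rule prob_space_path_measure)
  have "prob {X \<in> space (path_measure K x). X 0 = x} = 1"
    using measure_path_measure_cylinder[of 0 "\<lambda>_. x"] by simp
  then show ?thesis
    by (subst (asm) prob_Collect_eq_1) (use measurable_sets[OF measurable_path_measure, of "{x}" 0] in \<open>auto simp: vimage_def\<close>)
qed

lemma markov_chain_path_measure:
  assumes S: "countable S" "\<And>y. y \<in> S \<Longrightarrow> set_pmf (K y) \<subseteq> S" "x \<in> S"
  shows "markov_chain S K (path_measure K x) (\<lambda>n X. X n)"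
proof -
  interpret prob_space "path_measure K x" by (rule prob_space_path_measure)
  have step: "measure (path_measure K x) {X. \<forall>i\<le>Suc n. X i = y i} =
      measure (path_measure K x) {X. \<forall>i\<le>n. X i = y i} * pmf (K (y n)) (y (Suc n))" for n y
    unfolding measure_path_measure_cylinder by simp
  let ?u = "\<lambda>_::nat. undefined :: 's"
  let ?N = "\<lambda>n. PiM {0..<n} (\<lambda>_::nat. count_space (UNIV :: 's set))"
  have u: "?u \<in> space (?N 0)" by (simp add: space_PiM)
  have sC: "space (IT.C 0 n ?u) = space (?N n)" for n
    using IT.space_C[OF u, of n] by simp
  have setsC: "sets (IT.C 0 n ?u) = sets (?N n)" for n
    using IT.sets_C[OF u, of n] by simp
  have B: "{\<omega> \<in> space (?N (Suc n)). \<omega> n \<in> - S} \<in> sets (?N (Suc n))" for n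
    using measurable_sets[OF measurable_component_singleton[of n "{0..<Suc n}" "\<lambda>_. count_space (UNIV :: 's set)"], of "- S"]
    by (simp add: vimage_def Int_def conj_commute)
  have step_null: "emeasure (IT.C 0 (Suc n) ?u) {\<omega> \<in> space (?N (Suc n)). \<omega> n \<in> - S} = 0"
    if prev: "AE \<omega> in IT.C 0 n ?u. n = 0 \<or> \<omega> (n - 1) \<in> S" for n
  proof -
    have "emeasure (IT.C 0 (Suc n) ?u) {\<omega> \<in> space (?N (Suc n)). \<omega> n \<in> - S} =
        (\<integral>\<^sup>+\<omega>. emeasure (IT.eP n \<omega>) {\<omega> \<in> space (?N (Suc n)). \<omega> n \<in> - S} \<partial>IT.C 0 n ?u)"
      using IT.measurable_eP[of n] B[of n] u
      by (simp, subst emeasure_bind[where N="?N (Suc n)"])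
         (auto simp: sC space_PiM PiE_eq_empty_iff setsC cong: measurable_cong_sets)
    also have "\<dots> = (\<integral>\<^sup>+\<omega>. 0 \<partial>IT.C 0 n ?u)"
    proof (rule nn_integral_cong_AE)
      show "AE \<omega> in IT.C 0 n ?u. emeasure (IT.eP n \<omega>) {\<omega> \<in> space (?N (Suc n)). \<omega> n \<in> - S} = 0"
        using prev AE_space
      proof eventually_elim
        case (elim \<omega>)
        then have w: "\<omega> \<in> space (?N n)" by (simp add: sC)
        have "fun_upd \<omega> n -` {\<omega> \<in> space (?N (Suc n)). \<omega> n \<in> - S} \<subseteq> - S"
          by auto
        then have "emeasure (IT.eP n \<omega>) {\<omega> \<in> space (?N (Suc n)). \<omega> n \<in> - S} \<le>
            emeasure (path_step K x n \<omega>) (- S)"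
          using IT.emeasure_eP[OF w B[of n]]
          by (auto simp: path_step_def intro!: emeasure_mono)
        also have "\<dots> = 0"
          using elim(1) S
          by (cases n) (auto simp: path_step_def measure_pmf.emeasure_eq_measure measure_pmf_zero_iff)
        finally show ?case by simp
      qed
    qed
    finally show ?thesis by simp
  qed
  have AE_C: "AE \<omega> in IT.C 0 n ?u. n = 0 \<or> \<omega> (n - 1) \<in> S" for n
  proof (induction n)
    case (Suc n)
    show ?case
      by (rule AE_I[OF _ step_null[OF Suc.IH]]) (use B[of n] in \<open>auto simp: sC setsC[of "Suc n"] simp del: IT.C.simps\<close>)
  qed simp
  have "AE X in path_measure K x. X n \<in> S" for n
  proof (rule AE_I)
    let ?B = "{\<omega> \<in> space (?N (Suc n)). \<omega> n \<in> - S}"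
    have "{X. X n \<in> - S} = IT.PF.emb UNIV {0..<Suc n} ?B"
      by (auto simp: prod_emb_def space_PiM)
    then have "emeasure (path_measure K x) {X. X n \<in> - S} = emeasure (IT.CI {0..<Suc n}) ?B"
      unfolding path_measure_eq by (simp only: IT.lim[OF finite_atLeastLessThan B])
    also have "\<dots> = emeasure (IT.C 0 (Suc n) ?u) (IT.PF.emb {0..<Suc n} {0..<Suc n} ?B)"
      by (rule IT.emeasure_CI[OF subset_refl B])
    also have "IT.PF.emb {0..<Suc n} {0..<Suc n} ?B = ?B"
      by (rule prod_emb_id) (auto simp: space_PiM)
    also note step_null[OF AE_C]
    finally show "emeasure (path_measure K x) {X. X n \<in> - S} = 0" .
    show "{X. X n \<in> - S} \<in> sets (path_measure K x)"
      using measurable_sets[OF measurable_path_measure, of "- S" n] by (simp add: vimage_def)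
  qed auto
  with S step show ?thesis
    by (simp add: markov_chain_def prob_space_axioms measurable_path_measure)
qed

end

definition centred_walk :: "(nat \<Rightarrow> 'w \<Rightarrow> nat ^ 'm::finite) \<Rightarrow> nat \<Rightarrow> 'w \<Rightarrow> real ^ 'm" where
  "centred_walk R n \<omega> = (\<chi> i. real (R n \<omega> $ i) - real n / real CARD('m))"

definition centred_unit :: "'m::finite \<Rightarrow> real ^ 'm" where
  "centred_unit l = axis l 1 - (\<chi> i. 1 / real CARD('m))"

definition centred_lattice :: "(real ^ 'm::finite) set" where
  "centred_lattice = range (\<lambda>c :: 'm \<Rightarrow> int. \<Sum>l\<in>UNIV. of_int (c l) *\<^sub>R centred_unit l)"

text \<open>From \<^term>\<open>x\<close> the centred walk moves to \<^term>\<open>x + centred_unit l\<close> with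
  probability \<^term>\<open>p l\<close>; \<^const>\<open>embed_pmf\<close> requires \<^term>\<open>p\<close> to be a probability
  vector.\<close>

definition centred_kernel :: "('m::finite \<Rightarrow> real) \<Rightarrow> real ^ 'm \<Rightarrow> (real ^ 'm) pmf" where
  "centred_kernel p x = map_pmf (\<lambda>l. x + centred_unit l) (embed_pmf p)"

end

theory Submission
  imports Defs
begin

text \<open>A word over the \<open>m\<close> letters is a finite run of the increments, and the walk is back at its
  starting point after a word \<open>l\<close> iff \<open>l\<close> contains all letters equally often.  Hence returns
  occur only at times \<open>m * k\<close>, with multinomial probability
  \<open>u\<^sub>m\<^sub>k = (m k)! / (k!)\<^sup>m * (p\<^sub>1 \<cdots> p\<^sub>m)\<^sup>k\<close>.  By the renewal equation the return
  probability is less than 1 iff \<open>\<Sum>\<^sub>k u\<^sub>m\<^sub>k\<close> converges.  If \<open>p\<close> is not uniform then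
  \<open>m\<^sup>m p\<^sub>1 \<cdots> p\<^sub>m < 1\<close> by AM-GM, and the series is dominated by a geometric one.  If \<open>p\<close> is uniform,
  the ratio of consecutive terms is \<open>\<Prod>\<^sub>i\<^sub><\<^sub>m (1 - i / (m (k + 1)))\<close>, so that \<open>u\<^sub>m\<^sub>k\<close> is at most
  \<open>(k + 1)\<close> to the power \<open>-(m - 1)/2\<close>, and for \<open>m \<le> 3\<close> it is at least a multiple of \<open>1/k\<close>.\<close>

subsection \<open>Renewal sequences\<close>

text \<open>Summing the renewal equation by the Cauchy product would give
  \<open>suminf u = 1 + suminf f * suminf u\<close>, which is impossible for a convergent series
  \<open>u\<close> when \<open>suminf f = 1\<close>.\<close>

lemma renewal_transient:
  fixes u f :: "nat \<Rightarrow> real"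
  assumes "u 0 = 1" "\<And>n. 0 \<le> u n" "\<And>n. 0 \<le> f n" "f 0 = 0"
    and renewal: "\<And>n. n > 0 \<Longrightarrow> u n = (\<Sum>k\<le>n. f k * u (n - k))"
    and "summable u" "summable f"
  shows "suminf f \<noteq> 1"
proof
  assume F: "suminf f = 1"
  have "(\<lambda>n. \<Sum>k\<le>n. f k * u (n - k)) sums (suminf f * suminf u)"
    using assms by (intro Cauchy_product_sums) auto
  \<comment> \<open>The renewal equation is only available for positive indices. At 0 the
    convolution is \<open>f 0 * u 0 = 0\<close>, which is \<open>u 0 - 1\<close>; this is the source
    of the constant 1.\<close>
  moreover have "(\<Sum>k\<le>n. f k * u (n - k)) = (if n = 0 then u n - 1 else u n)" for n
    using renewal[of n] assms by auto
  ultimately have "(\<lambda>n. if n = 0 then u n - 1 else u n) sums suminf u"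
    using F by simp
  moreover have "(\<lambda>n. u n - (if n = 0 then 1 else 0)) sums (suminf u - 1)"
    using assms(6) sums_single[of 0 "\<lambda>_. 1::real"] by (intro sums_diff) (auto simp: summable_sums)
  moreover have "(\<lambda>n. u n - (if n = 0 then 1 else 0)) = (\<lambda>n. if n = 0 then u n - 1 else u n)"
    by auto
  ultimately have "suminf u = suminf u - 1"
    by (metis sums_unique2)
  then show False by simp
qed

text \<open>If \<open>suminf f\<close> were below 1, each partial sum S of \<open>u\<close> would
  satisfy S \<le> 1 + \<open>suminf f\<close> * S. That bounds S by 1 / (1 -
  \<open>suminf f\<close>), and nonnegative terms with bounded partial sums are summable.\<close>

lemma renewal_recurrent:
  fixes u f :: "nat \<Rightarrow> real"
  assumes "u 0 = 1" "\<And>n. 0 \<le> u n" "\<And>n. 0 \<le> f n" "f 0 = 0"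
    and renewal: "\<And>n. n > 0 \<Longrightarrow> u n = (\<Sum>k\<le>n. f k * u (n - k))"
    and "summable f" "\<not> summable u"
  shows "suminf f \<ge> 1"
proof (rule ccontr)
  assume "\<not> suminf f \<ge> 1"
  then have F: "suminf f < 1" by simp
  have "(\<Sum>n\<le>N. u n) \<le> 1 / (1 - suminf f)" for N
  proof -
    have "(\<Sum>n\<le>N. u n) = u 0 + (\<Sum>n\<in>{..N} - {0}. u n)"
      by (subst sum.remove[of _ 0]) auto
    also have "\<dots> = 1 + (\<Sum>n\<in>{..N} - {0}. \<Sum>k\<le>n. f k * u (n - k))"
      using assms(1) renewal by (auto intro!: sum.cong)
    also have "\<dots> \<le> 1 + (\<Sum>n\<le>N. \<Sum>k\<le>n. f k * u (n - k))"
      by (intro add_left_mono sum_mono2) (auto intro!: sum_nonneg mult_nonneg_nonneg assms)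
    also have "(\<Sum>n\<le>N. \<Sum>k\<le>n. f k * u (n - k)) = (\<Sum>(k, j)\<in>{(k, j). k + j \<le> N}. f k * u j)"
      by (rule sum.triangle_reindex_eq[symmetric])
    \<comment> \<open>Since all terms are nonnegative, the triangle may be enlarged to a square,
      over which the double sum factors.\<close>
    also have "\<dots> \<le> (\<Sum>(k, j)\<in>{..N} \<times> {..N}. f k * u j)"
      by (intro sum_mono2) (auto intro!: mult_nonneg_nonneg assms)
    also have "\<dots> = (\<Sum>k\<le>N. f k) * (\<Sum>j\<le>N. u j)"
      by (simp add: sum_product sum.cartesian_product)
    also have "\<dots> \<le> suminf f * (\<Sum>j\<le>N. u j)"
      by (intro mult_right_mono sum_le_suminf sum_nonneg assms) auto
    finally show ?thesis
      using F by (simp add: field_simps)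
  qed
  then have "summable u"
    by (intro bounded_imp_summable assms)
  with assms show False by simp
qed

subsection \<open>Words with zero sum\<close>

definition word_weight :: "('a \<Rightarrow> real) \<Rightarrow> 'a list \<Rightarrow> real" where
  "word_weight p l = prod_list (map p l)"

definition zero_word :: "('a \<Rightarrow> 'b::monoid_add) \<Rightarrow> 'a list \<Rightarrow> bool" where
  "zero_word c l \<longleftrightarrow> sum_list (map c l) = 0"

definition first_zero_word :: "('a \<Rightarrow> 'b::monoid_add) \<Rightarrow> 'a list \<Rightarrow> bool" where
  "first_zero_word c l \<longleftrightarrow> l \<noteq> [] \<and> zero_word c l \<and>
     (\<forall>i. 0 < i \<and> i < length l \<longrightarrow> \<not> zero_word c (take i l))"

text \<open>This weight and the next one play the roles of \<open>u\<close> and \<open>f\<close> in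
  the renewal lemmas: the probabilities of a return, respectively of a first return, at time
  \<open>n\<close>.\<close>

definition zero_weight :: "('a::finite \<Rightarrow> real) \<Rightarrow> ('a \<Rightarrow> 'b::monoid_add) \<Rightarrow> nat \<Rightarrow> real" where
  "zero_weight p c n = (\<Sum>l | length l = n \<and> zero_word c l. word_weight p l)"

definition first_zero_weight :: "('a::finite \<Rightarrow> real) \<Rightarrow> ('a \<Rightarrow> 'b::monoid_add) \<Rightarrow> nat \<Rightarrow> real" where
  "first_zero_weight p c n = (\<Sum>l | length l = n \<and> first_zero_word c l. word_weight p l)"

lemma finite_words [simp]: "finite {l :: 'a::finite list. length l = n}"
  using finite_lists_length_eq[of "UNIV :: 'a set" n] by simp

lemma finite_words_Collect [simp]: "finite {l :: 'a::finite list. length l = n \<and> P l}"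
  by (rule finite_subset[OF _ finite_words[of n]]) auto

lemma word_weight_nonneg: "(\<And>a. 0 \<le> p a) \<Longrightarrow> 0 \<le> word_weight p l"
  unfolding word_weight_def by (induction l) auto

lemma word_weight_append: "word_weight p (l @ l') = word_weight p l * word_weight p l'"
  by (simp add: word_weight_def)

lemma sum_word_weight:
  fixes p :: "'a::finite \<Rightarrow> real"
  assumes "(\<Sum>a\<in>UNIV. p a) = 1"
  shows "(\<Sum>l | length l = n. word_weight p l) = 1"
proof (induction n)
  case (Suc n)
  have "(\<Sum>l | length l = Suc n. word_weight p l) =
      (\<Sum>(a, l)\<in>UNIV \<times> {l. length l = n}. p a * word_weight p l)"
    by (rule sum.reindex_bij_witness[of _ "\<lambda>(a, l). a # l" "\<lambda>l. (hd l, tl l)"])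
       (auto simp: length_Suc_conv word_weight_def)
  also have "\<dots> = (\<Sum>a\<in>UNIV. p a) * (\<Sum>l | length l = n. word_weight p l)"
    by (simp add: sum_product sum.cartesian_product)
  finally show ?case
    using assms Suc by simp
qed (simp add: word_weight_def)

lemma zero_word_append:
  "zero_word c l \<Longrightarrow> zero_word c (l @ l') \<longleftrightarrow> zero_word c l'"
  by (simp add: zero_word_def)

text \<open>Cut a zero word at its earliest return. The prefix is a first zero word, the suffix is
  an arbitrary zero word, and weights are multiplicative under concatenation.\<close>

lemma zero_weight_renewal:
  fixes p :: "'a::finite \<Rightarrow> real" and c :: "'a \<Rightarrow> 'b::monoid_add"
  assumes "n > 0"
  shows "zero_weight p c n = (\<Sum>k\<le>n. first_zero_weight p c k * zero_weight p c (n - k))"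
proof -
  \<comment> \<open>The place of the cut. For a zero word of length \<open>n\<close> the minimum
    exists because \<open>n\<close> itself is a candidate; this uses \<open>n > 0\<close>.\<close>
  define T where "T l = (LEAST k. 0 < k \<and> zero_word c (take k l))" for l
  have T: "0 < T l" "zero_word c (take (T l) l)" "T l \<le> n"
      "0 < i \<Longrightarrow> i < T l \<Longrightarrow> \<not> zero_word c (take i l)"
    if "length l = n" "zero_word c l" for l i
  proof -
    have ex: "0 < n \<and> zero_word c (take n l)"
      using that assms by simp
    show "0 < T l" "zero_word c (take (T l) l)"
      using LeastI[of "\<lambda>k. 0 < k \<and> zero_word c (take k l)", OF ex] by (auto simp: T_def)
    show "T l \<le> n"
      using ex unfolding T_def by (rule Least_le)
    show "0 < i \<Longrightarrow> i < T l \<Longrightarrow> \<not> zero_word c (take i l)"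
      using not_less_Least[of i "\<lambda>k. 0 < k \<and> zero_word c (take k l)"] by (auto simp: T_def)
  qed
  \<comment> \<open>Gluing does not move the cut: whatever follows a first zero word, the earliest
    return is at its end. Hence gluing inverts cutting.\<close>
  have T_append: "T (l @ l') = length l" if "first_zero_word c l" for l l'
    unfolding T_def
  proof (rule Least_equality)
    show "0 < length l \<and> zero_word c (take (length l) (l @ l'))"
      using that by (auto simp: first_zero_word_def)
    show "length l \<le> k" if k: "0 < k \<and> zero_word c (take k (l @ l'))" for k
    proof (rule ccontr)
      assume "\<not> length l \<le> k"
      then show False
        using k \<open>first_zero_word c l\<close> by (auto simp: first_zero_word_def not_le)
    qed
  qed
  have "zero_weight p c n =
      (\<Sum>k\<le>n. \<Sum>l\<in>{l. l \<in> {l. length l = n \<and> zero_word c l} \<and> T l = k}. word_weight p l)"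
    unfolding zero_weight_def using T(3) by (intro sum.group[symmetric]) auto
  also have "\<dots> = (\<Sum>k\<le>n. first_zero_weight p c k * zero_weight p c (n - k))"
  proof (rule sum.cong[OF refl])
    fix k assume "k \<in> {..n}"
    then have k: "k \<le> n" by simp
    have "(\<Sum>l\<in>{l. l \<in> {l. length l = n \<and> zero_word c l} \<and> T l = k}. word_weight p l) =
        (\<Sum>(l, l')\<in>{l. length l = k \<and> first_zero_word c l} \<times> {l. length l = n - k \<and> zero_word c l}.
            word_weight p l * word_weight p l')"
    proof (rule sum.reindex_bij_witness[of _ "\<lambda>(l, l'). l @ l'" "\<lambda>l. (take k l, drop k l)"], goal_cases)
      \<comment> \<open>Both pieces are of the required kind: minimality of the cut excludes earlier
        returns in the prefix, and cancelling a zero prefix leaves a zero suffix.\<close>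
      case (2 l)
      then have l: "length l = n" "zero_word c l" "T l = k" by auto
      have z: "zero_word c (take k l)" using T[OF l(1,2)] l(3) by simp
      have "zero_word c (drop k l)"
        using zero_word_append[OF z, of "drop k l"] l by simp
      then show ?case
        using T(1,4)[OF l(1,2)] l k z by (auto simp: first_zero_word_def min_def)
    next
      case (5 l)
      then show ?case by (simp add: word_weight_append[symmetric])
    qed (use k T_append in \<open>auto simp: zero_word_append first_zero_word_def\<close>)
    also have "\<dots> = first_zero_weight p c k * zero_weight p c (n - k)"
      by (simp add: sum_product sum.cartesian_product first_zero_weight_def zero_weight_def)
    finally show "(\<Sum>l\<in>{l. l \<in> {l. length l = n \<and> zero_word c l} \<and> T l = k}. word_weight p l) =
       first_zero_weight p c k * zero_weight p c (n - k)" .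
  qed
  finally show ?thesis .
qed

lemma first_zero_weight_0 [simp]: "first_zero_weight p c 0 = 0"
  unfolding first_zero_weight_def by (rule sum.neutral) (auto simp: first_zero_word_def)

lemma zero_weight_0 [simp]: "zero_weight p c 0 = 1"
proof -
  have "{l :: 'a list. length l = 0 \<and> zero_word c l} = {[]}"
    by (auto simp: zero_word_def)
  then show ?thesis by (simp add: zero_weight_def word_weight_def)
qed

subsection \<open>The path measure of a walk with i.i.d. increments\<close>

definition word_cylinder :: "('a \<Rightarrow> 's::monoid_add) \<Rightarrow> 's \<Rightarrow> 'a list \<Rightarrow> (nat \<Rightarrow> 's) set" where
  "word_cylinder c x l = {X. \<forall>i\<le>length l. X i = x + sum_list (map c (take i l))}"

text \<open>Successive differences of the trajectory are the values of \<open>c\<close> on the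
  letters, so an injective \<open>c\<close> lets the word be read back. Cylinders of distinct words
  of equal length are therefore disjoint.\<close>

lemma word_cylinder_inj:
  fixes c :: "'a \<Rightarrow> 's::group_add"
  assumes "inj c" "length l = length l'" "X \<in> word_cylinder c x l" "X \<in> word_cylinder c x l'"
  shows "l = l'"
proof (rule nth_equalityI)
  fix i assume i: "i < length l"
  have "X (Suc i) = X i + c (k ! i)" if "length k = length l" "X \<in> word_cylinder c x k" for k
    using that i by (simp add: word_cylinder_def take_Suc_conv_app_nth add.assoc)
  from this[of l] this[of l'] have "c (l ! i) = c (l' ! i)"
    using assms by auto
  then show "l ! i = l' ! i"
    using assms(1) by (simp add: inj_eq)
qed (fact assms)

lemma sets_path_measure_Collect_eq:
  "{X. X n = y} \<in> sets (path_measure K x)"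
  using measurable_sets[OF measurable_path_measure, of "{y}" n K x] by (simp add: vimage_def)

text \<open>\<open>pmf_K\<close> expresses i.i.d. increments: the step \<open>c a\<close> has the
  same probability at every \<open>y\<close>. By \<open>p_sum\<close> and \<open>inj_c\<close> these
  steps carry the whole mass of \<open>K y\<close>.\<close>

locale lattice_walk =
  fixes p :: "'a::finite \<Rightarrow> real" and c :: "'a \<Rightarrow> 's::ab_group_add" and K :: "'s \<Rightarrow> 's pmf"
  assumes p_nonneg: "0 \<le> p a"
    and p_sum: "(\<Sum>a\<in>UNIV. p a) = 1"
    and inj_c: "inj c"
    and pmf_K: "pmf (K y) (y + c a) = p a"
begin

lemma sets_word_cylinder: "word_cylinder c x l \<in> sets (path_measure K y)"
proof -
  have "word_cylinder c x l = (\<Inter>i\<in>{..length l}. {X. X i = x + sum_list (map c (take i l))})"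
    by (auto simp: word_cylinder_def)
  also have "\<dots> \<in> sets (path_measure K y)"
    by (intro sets.finite_INT sets_path_measure_Collect_eq) auto
  finally show ?thesis .
qed

lemma measure_word_cylinder:
  "measure (path_measure K x) (word_cylinder c x l) = word_weight p l"
proof -
  have "measure (path_measure K x) (word_cylinder c x l) = (\<Prod>i<length l. p (l ! i))"
    unfolding word_cylinder_def measure_path_measure_cylinder
    by (auto simp: take_Suc_conv_app_nth add.assoc[symmetric] pmf_K intro!: prod.cong)
  also have "\<dots> = word_weight p l"
    by (simp add: word_weight_def prod.list_conv_set_nth atLeast0LessThan)
  finally show ?thesis .
qed

text \<open>Reduces path probabilities to finite sums over words: the cylinders of words of length
  \<open>n\<close> are disjoint with total mass 1, and on each of them membership in
  \<open>E\<close> is decided by the word.\<close>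

lemma measure_path_event:
  assumes E: "E \<in> sets (path_measure K x)"
    and \<phi>: "\<And>X l. length l = n \<Longrightarrow> X \<in> word_cylinder c x l \<Longrightarrow> X \<in> E \<longleftrightarrow> \<phi> l"
  shows "measure (path_measure K x) E = (\<Sum>l | length l = n \<and> \<phi> l. word_weight p l)"
proof -
  interpret prob_space "path_measure K x" by (rule prob_space_path_measure)
  have UN: "prob (\<Union>l\<in>{l. length l = n \<and> \<psi> l}. word_cylinder c x l) =
      (\<Sum>l | length l = n \<and> \<psi> l. word_weight p l)" for \<psi>
    by (subst finite_measure_finite_Union)
       (auto simp: measure_word_cylinder disjoint_family_on_def sets_word_cylinder
             dest: word_cylinder_inj[OF inj_c])
  let ?A = "\<Union>l\<in>{l. length l = n \<and> True}. word_cylinder c x l"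
  have "?A \<in> events"
    by (intro sets.finite_UN sets_word_cylinder) auto
  moreover have "prob ?A = 1"
    unfolding UN using sum_word_weight[OF p_sum, of n] by simp
  \<comment> \<open>The cylinders cover the path space up to a null set, so trajectories with other
    steps can be ignored.\<close>
  ultimately have "prob (E \<inter> ?A) = prob E"
    using E by (intro measure_eq_AE) (auto dest: prob_eq_1[THEN iffD1])
  moreover have "E \<inter> ?A = (\<Union>l\<in>{l. length l = n \<and> \<phi> l}. word_cylinder c x l)"
    using \<phi> by auto
  ultimately show ?thesis
    using UN by simp
qed

text \<open>The event of returning is the disjoint union, over positive times, of the events of a
  first return at that time.\<close>

lemma first_zero_weight_sums: "first_zero_weight p c sums return_probability K x"
proof -
  interpret prob_space "path_measure K x" by (rule prob_space_path_measure)
  \<comment> \<open>Time 0 is left out of the union because the trajectory starts at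
    \<open>x\<close> almost surely.\<close>
  define E :: "nat \<Rightarrow> (nat \<Rightarrow> 's) set" where "E n = {X. X n = x} - (\<Union>i\<in>{0<..<n}. {X. X i = x})" for n
  have E_events: "E n \<in> events" for n
    unfolding E_def by (intro sets.Diff sets.finite_UN sets_path_measure_Collect_eq) auto
  have "prob (E (Suc n)) = first_zero_weight p c (Suc n)" for n
    unfolding first_zero_weight_def
  proof (rule measure_path_event[OF E_events])
    fix X l assume l: "length l = Suc n" and X: "X \<in> word_cylinder c x l"
    have "X i = x \<longleftrightarrow> zero_word c (take i l)" if "i \<le> Suc n" for i
      using X that l by (simp add: word_cylinder_def zero_word_def)
    then show "X \<in> E (Suc n) \<longleftrightarrow> first_zero_word c l"
      using l by (auto simp: E_def first_zero_word_def)
  qed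
  moreover have "(\<lambda>n. prob (E (Suc n))) sums prob (\<Union>n. E (Suc n))"
  proof (rule finite_measure_UNION)
    show "disjoint_family (\<lambda>n. E (Suc n))"
      unfolding disjoint_family_on_def
    proof (intro ballI impI)
      fix m n :: nat assume "m \<noteq> n"
      then show "E (Suc m) \<inter> E (Suc n) = {}"
        by (cases m n rule: linorder_cases) (auto simp: E_def)
    qed
  qed (use E_events in auto)
  moreover have "(\<Union>n. E (Suc n)) = {X. \<exists>n\<ge>(1::nat). X n = x}"
  proof (intro equalityI subsetI)
    fix X assume "X \<in> {X. \<exists>n\<ge>(1::nat). X n = x}"
    then obtain n where "1 \<le> n" "X n = x" by blast
    then have ex: "\<exists>n. 0 < n \<and> X n = x"
      by (intro exI[of _ n]) auto
    define k where "k = (LEAST n. 0 < n \<and> X n = x)"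
    have "0 < k \<and> X k = x"
      unfolding k_def using ex by (rule LeastI_ex)
    moreover have "\<not> (0 < i \<and> X i = x)" if "i < k" for i
      using that unfolding k_def by (rule not_less_Least)
    ultimately have "X \<in> E (Suc (k - 1))"
      unfolding E_def by fastforce
    then show "X \<in> (\<Union>n. E (Suc n))" by blast
  qed (auto simp: E_def)
  ultimately have "(\<lambda>n. first_zero_weight p c (Suc n)) sums return_probability K x"
    by (simp add: return_probability_def)
  then show ?thesis
    by (simp add: sums_Suc_iff)
qed

lemma zero_weight_nonneg: "0 \<le> zero_weight p c n"
  unfolding zero_weight_def by (intro sum_nonneg word_weight_nonneg p_nonneg)

lemma first_zero_weight_nonneg: "0 \<le> first_zero_weight p c n"
  unfolding first_zero_weight_def by (intro sum_nonneg word_weight_nonneg p_nonneg)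

text \<open>Both renewal lemmas apply, and a return probability is at most 1. The series does not
  depend on \<open>x\<close>, so all states are of the same type.\<close>

lemma transient_state_iff: "transient_state K x \<longleftrightarrow> summable (zero_weight p c)"
  and recurrent_state_iff: "recurrent_state K x \<longleftrightarrow> \<not> summable (zero_weight p c)"
proof -
  interpret prob_space "path_measure K x" by (rule prob_space_path_measure)
  have le: "return_probability K x \<le> 1"
    unfolding return_probability_def by (rule prob_le_1)
  have F: "summable (first_zero_weight p c)" "suminf (first_zero_weight p c) = return_probability K x"
    using first_zero_weight_sums[of x] by (auto simp: sums_iff)
  note hyps = zero_weight_0 zero_weight_nonneg first_zero_weight_nonneg first_zero_weight_0
    zero_weight_renewal
  have "return_probability K x \<noteq> 1" if "summable (zero_weight p c)"
    using renewal_transient[OF hyps that F(1)] F(2) by simp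
  moreover have "return_probability K x \<ge> 1" if "\<not> summable (zero_weight p c)"
    using renewal_recurrent[OF hyps F(1) that] F(2) by simp
  ultimately show "transient_state K x \<longleftrightarrow> summable (zero_weight p c)"
      "recurrent_state K x \<longleftrightarrow> \<not> summable (zero_weight p c)"
    using le unfolding transient_state_def recurrent_state_def by fastforce+
qed

end

subsection \<open>Balanced words\<close>

lemma word_weight_eq_prod_count:
  fixes p :: "'a::finite \<Rightarrow> real"
  shows "word_weight p l = (\<Prod>a\<in>UNIV. p a ^ count (mset l) a)"
proof (induction l)
  case (Cons b l)
  have "(\<Prod>a\<in>UNIV. p a ^ count (mset (b # l)) a) =
      (\<Prod>a\<in>UNIV. (if a = b then p a else 1) * p a ^ count (mset l) a)"
    by (intro prod.cong) auto
  then show ?case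
    using Cons by (simp add: prod.distrib word_weight_def)
qed (simp add: word_weight_def)

text \<open>Each letter \<open>j\<close> adds 1 to coordinate \<open>j\<close>, and every letter
  subtracts 1/m from all coordinates. Clearing denominators turns the vanishing of a coordinate into
  an equation in natural numbers.\<close>

lemma zero_word_centred_unit_iff:
  fixes l :: "'m::finite list"
  shows "zero_word centred_unit l \<longleftrightarrow> (\<forall>j. CARD('m) * count (mset l) j = length l)"
proof -
  have sum_nth: "sum_list (map centred_unit l) $ j =
      real (count (mset l) j) - real (length l) / real CARD('m)" for j
    by (induction l) (auto simp: centred_unit_def axis_def add_divide_distrib)
  have "sum_list (map centred_unit l) $ j = 0 \<longleftrightarrow> CARD('m) * count (mset l) j = length l" for j
  proof -
    have "sum_list (map centred_unit l) $ j = 0 \<longleftrightarrow>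
        real (CARD('m) * count (mset l) j) = real (length l)"
      unfolding sum_nth by (simp add: field_simps)
    then show ?thesis by (simp only: of_nat_eq_iff)
  qed
  then show ?thesis
    by (simp add: zero_word_def vec_eq_iff)
qed

lemma zero_weight_centred_unit_eq_0:
  fixes p :: "'m::finite \<Rightarrow> real"
  assumes "\<not> CARD('m) dvd n"
  shows "zero_weight p centred_unit n = 0"
proof -
  have "\<not> zero_word centred_unit l" if "length l = n" for l :: "'m list"
    using assms that by (metis dvd_triv_left zero_word_centred_unit_iff)
  then have "{l :: 'm list. length l = n \<and> zero_word centred_unit l} = {}"
    by blast
  then show ?thesis
    unfolding zero_weight_def by (simp only: sum.empty)
qed

definition balanced_mset :: "nat \<Rightarrow> 'm::finite multiset" where
  "balanced_mset k = (\<Sum>j\<in>UNIV. replicate_mset k j)"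

lemma count_balanced_mset [simp]: "count (balanced_mset k) j = k"
  by (simp add: balanced_mset_def count_sum)

lemma size_balanced_mset [simp]: "size (balanced_mset k :: 'm::finite multiset) = CARD('m) * k"
  by (simp add: balanced_mset_def)

text \<open>The zero words of this length are the rearrangements of one multiset, and the weight of
  a word depends only on its multiset.\<close>

lemma zero_weight_centred_unit:
  fixes p :: "'m::finite \<Rightarrow> real"
  shows "zero_weight p centred_unit (CARD('m) * k) =
     card (permutations_of_multiset (balanced_mset k :: 'm multiset)) * (\<Prod>j\<in>UNIV. p j) ^ k"
proof -
  have words: "{l :: 'm list. length l = CARD('m) * k \<and> zero_word centred_unit l} =
      permutations_of_multiset (balanced_mset k)"
  proof (intro equalityI subsetI)
    fix l :: "'m list" assume "l \<in> {l. length l = CARD('m) * k \<and> zero_word centred_unit l}"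
    then have "CARD('m) * count (mset l) j = CARD('m) * k" for j
      by (simp add: zero_word_centred_unit_iff)
    then have "mset l = balanced_mset k"
      by (intro multiset_eqI) simp
    then show "l \<in> permutations_of_multiset (balanced_mset k)"
      by (simp add: permutations_of_multiset_def)
  next
    fix l :: "'m list" assume "l \<in> permutations_of_multiset (balanced_mset k)"
    then have l: "mset l = balanced_mset k"
      by (simp add: permutations_of_multiset_def)
    moreover have "length l = CARD('m) * k"
      using arg_cong[OF l, of size] by simp
    ultimately show "l \<in> {l. length l = CARD('m) * k \<and> zero_word centred_unit l}"
      by (simp add: zero_word_centred_unit_iff)
  qed
  have "zero_weight p centred_unit (CARD('m) * k) =
      (\<Sum>l\<in>permutations_of_multiset (balanced_mset k :: 'm multiset). (\<Prod>j\<in>UNIV. p j) ^ k)"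
    unfolding zero_weight_def words
    by (intro sum.cong)
       (auto simp: word_weight_eq_prod_count permutations_of_multiset_def prod_power_distrib)
  then show ?thesis by simp
qed

lemma card_permutations_balanced_mset:
  "real (card (permutations_of_multiset (balanced_mset k :: 'm::finite multiset))) =
     fact (CARD('m) * k) / fact k ^ CARD('m)"
proof -
  let ?A = "balanced_mset k :: 'm multiset"
  \<comment> \<open>Letters outside the support contribute \<open>fact 0 = 1\<close>. This matters
    for \<open>k = 0\<close>, where the support is empty.\<close>
  have "(\<Prod>x\<in>set_mset ?A. fact (count ?A x)) = (\<Prod>x\<in>(UNIV :: 'm set). fact (count ?A x) :: nat)"
    by (rule prod.mono_neutral_left) (auto simp: not_in_iff)
  then have "card (permutations_of_multiset ?A) * fact k ^ CARD('m) = fact (CARD('m) * k)"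
    using card_permutations_of_multiset_aux[of ?A] by simp
  then have "real (card (permutations_of_multiset ?A)) * fact k ^ CARD('m) = fact (CARD('m) * k)"
    by (metis of_nat_fact of_nat_mult of_nat_power)
  then show ?thesis
    by (simp add: field_simps)
qed

lemma summable_zero_weight_centred_unit_iff:
  fixes p :: "'m::finite \<Rightarrow> real"
  shows "summable (zero_weight p centred_unit) \<longleftrightarrow>
     summable (\<lambda>k. zero_weight p centred_unit (CARD('m) * k))"
proof (rule summable_mono_reindex[symmetric])
  show "strict_mono (\<lambda>k. CARD('m) * k)"
    by (simp add: strict_mono_def)
  show "zero_weight p centred_unit n = 0" if "n \<notin> range (\<lambda>k. CARD('m) * k)" for n
    using that by (intro zero_weight_centred_unit_eq_0) (auto elim!: dvdE)
qed

text \<open>Strict AM-GM for the numbers \<open>q l\<close>, whose mean is 1: multiply the bounds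
  \<open>q l \<le> exp (q l - 1)\<close>, whose exponents sum to 0. The bound at \<open>j\<close> is
  strict because \<open>q j \<noteq> 1\<close>.\<close>

lemma prod_less_uniform:
  fixes p :: "'m::finite \<Rightarrow> real"
  assumes "\<And>l. 0 \<le> p l" "(\<Sum>l\<in>UNIV. p l) = 1" and j: "p j \<noteq> 1 / real CARD('m)"
  shows "real CARD('m) ^ CARD('m) * (\<Prod>l\<in>UNIV. p l) < 1"
proof -
  define q where "q l = real CARD('m) * p l" for l
  have exp_bound: "q l \<le> exp (q l - 1)" for l
    using exp_ge_add_one_self[of "q l - 1"] by simp
  have q: "q j \<noteq> 1" "0 \<le> q l" for l
    using j assms(1)[of l] by (auto simp: q_def field_simps)
  have "q j < exp (q j - 1)"
    using exp_bound[of j] q ln_eq_minus_one[of "q j"]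
    by (metis exp_gt_zero ln_exp order_le_less)
  have "real CARD('m) ^ CARD('m) * (\<Prod>l\<in>UNIV. p l) = (\<Prod>l\<in>UNIV. q l)"
    by (simp add: q_def prod.distrib)
  also have "\<dots> = q j * (\<Prod>l\<in>UNIV - {j}. q l)"
    by (rule prod.remove) auto
  \<comment> \<open>The factor at \<open>j\<close> is replaced last: the other \<open>q l\<close>
    may vanish, whereas the product of exponentials is positive and so preserves the strict
    inequality.\<close>
  also have "\<dots> \<le> q j * (\<Prod>l\<in>UNIV - {j}. exp (q l - 1))"
    by (intro mult_left_mono prod_mono) (use q exp_bound in auto)
  also have "\<dots> < exp (q j - 1) * (\<Prod>l\<in>UNIV - {j}. exp (q l - 1))"
    by (intro mult_strict_right_mono prod_pos \<open>q j < exp (q j - 1)\<close>) auto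
  also have "\<dots> = (\<Prod>l\<in>UNIV. exp (q l - 1))"
    by (rule prod.remove[symmetric]) auto
  also have "\<dots> = exp (\<Sum>l\<in>UNIV. q l - 1)"
    by (simp add: exp_sum)
  also have "(\<Sum>l\<in>UNIV. q l - 1) = 0"
    using assms(2) by (simp add: q_def sum_subtractf sum_distrib_left[symmetric])
  finally show ?thesis by simp
qed

text \<open>Bounding the number of balanced words by the number of all words of that length costs
  nothing in the exponential rate; what remains is a geometric series of ratio below 1.\<close>

lemma summable_zero_weight_nonuniform:
  fixes p :: "'m::finite \<Rightarrow> real"
  assumes "\<And>l. 0 \<le> p l" "(\<Sum>l\<in>UNIV. p l) = 1" "p j \<noteq> 1 / real CARD('m)"
  shows "summable (zero_weight p centred_unit)"
  unfolding summable_zero_weight_centred_unit_iff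
proof (rule summable_comparison_test)
  let ?r = "real CARD('m) ^ CARD('m) * (\<Prod>l\<in>UNIV. p l)"
  have P: "0 \<le> (\<Prod>l\<in>UNIV. p l)"
    by (intro prod_nonneg) (use assms in auto)
  show "summable (\<lambda>k. ?r ^ k)"
    using prod_less_uniform[OF assms] P by (intro summable_geometric) simp
  have "norm (zero_weight p centred_unit (CARD('m) * k)) \<le> ?r ^ k" for k
  proof -
    let ?W = "permutations_of_multiset (balanced_mset k :: 'm multiset)"
    have "?W \<subseteq> {l. set l \<subseteq> UNIV \<and> length l = CARD('m) * k}"
      by (auto simp: permutations_of_multiset_def simp flip: size_mset)
    then have "card ?W \<le> CARD('m) ^ (CARD('m) * k)"
      using card_mono[OF finite_lists_length_eq[of "UNIV :: 'm set" "CARD('m) * k"], of ?W]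
        card_lists_length_eq[of "UNIV :: 'm set" "CARD('m) * k"] by simp
    then have "real (card ?W) \<le> real CARD('m) ^ (CARD('m) * k)"
      by (metis of_nat_le_iff of_nat_power)
    then have "real (card ?W) * (\<Prod>l\<in>UNIV. p l) ^ k \<le>
        real CARD('m) ^ (CARD('m) * k) * (\<Prod>l\<in>UNIV. p l) ^ k"
      using P by (intro mult_right_mono) auto
    then show ?thesis
      using P by (simp add: zero_weight_centred_unit power_mult_distrib power_mult)
  qed
  then show "\<exists>N. \<forall>k\<ge>N. norm (zero_weight p centred_unit (CARD('m) * k)) \<le> ?r ^ k"
    by blast
qed

section \<open>Decay of the balance probabilities under the uniform law\<close>

text \<open>The probability that \<open>m * k\<close> uniform draws from \<open>m\<close> letters give each letter \<open>k\<close> times.\<close>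

definition uniform_balance :: "nat \<Rightarrow> nat \<Rightarrow> real" where
  "uniform_balance m k = fact (m * k) / (fact k ^ m * real m ^ (m * k))"

lemma fact_add: "(fact (n + j) :: real) = fact n * (\<Prod>i<j. real (n + i + 1))"
  by (induction j) (auto simp: algebra_simps)

text \<open>Passing to \<open>Suc k\<close> adds m factors to the factorial, the largest being m *
  (k + 1), and divides by the m-th power of that largest one. The factor with index \<open>i\<close>
  falls short of it by \<open>m - Suc i\<close>.\<close>

lemma uniform_balance_Suc:
  assumes "m > 0"
  shows "uniform_balance m (Suc k) =
     uniform_balance m k * (\<Prod>i<m. 1 - real (m - Suc i) / (real m * real (Suc k)))"
proof -
  have "real (m * k + i + 1) / (real m * real (Suc k)) =
      1 - real (m - Suc i) / (real m * real (Suc k))" if "i < m" for i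
  proof -
    have "real (m * k + i + 1) = real m * real (Suc k) - real (m - Suc i)"
      using that by (simp add: of_nat_diff algebra_simps)
    then show ?thesis
      using assms by (simp add: diff_divide_distrib del: of_nat_Suc)
  qed
  then have "(\<Prod>i<m. 1 - real (m - Suc i) / (real m * real (Suc k))) =
      (\<Prod>i<m. real (m * k + i + 1) / (real m * real (Suc k)))"
    by (intro prod.cong) auto
  also have "\<dots> = (\<Prod>i<m. real (m * k + i + 1)) / (real m * real (Suc k)) ^ m"
    by (simp only: prod_dividef prod_constant card_lessThan)
  finally have *: "(\<Prod>i<m. 1 - real (m - Suc i) / (real m * real (Suc k))) =
      (\<Prod>i<m. real (m * k + i + 1)) / (real m * real (Suc k)) ^ m" .
  have "fact (m * Suc k) = (fact (m * k) * (\<Prod>i<m. real (m * k + i + 1)) :: real)"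
    using fact_add[of "m * k" m] by (simp only: mult_Suc_right add.commute)
  moreover have "fact (Suc k) ^ m * real m ^ (m * Suc k) =
      (fact k ^ m * real m ^ (m * k)) * (real m * real (Suc k)) ^ m"
    by (simp add: power_mult_distrib power_add del: of_nat_Suc)
  ultimately show ?thesis
    unfolding * uniform_balance_def by (simp only: times_divide_times_eq)
qed

lemma uniform_balance_nonneg: "0 \<le> uniform_balance m k"
  by (simp add: uniform_balance_def)

text \<open>Applying 1 - x \<le> exp(-x) to each factor of the ratio turns the product into an
  exponential of a harmonic sum, and \<open>harm k\<close> is at least ln(k + 1).\<close>

lemma uniform_balance_le:
  assumes "m > 0"
  shows "uniform_balance m k \<le> real (Suc k) powr (- ((real m - 1) / 2))"
proof -
  let ?s = "(real m - 1) / 2"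
  have cancel: "real m * t / (real m * u) = t * inverse u" for t u :: real
    using assms by (simp add: divide_inverse)
  have "uniform_balance m k \<le> exp (- (?s * harm k))"
  proof (induction k)
    case (Suc k)
    have "(\<Prod>i<m. 1 - real (m - Suc i) / (real m * real (Suc k))) \<le>
        (\<Prod>i<m. exp (- (real (m - Suc i) / (real m * real (Suc k)))))"
    proof (rule prod_mono, intro conjI)
      \<comment> \<open>Bounding a product factor by factor requires nonnegative factors; here the
        deficit is at most m, hence at most m * (k + 1).\<close>
      fix i assume "i \<in> {..<m}"
      have "real (m - Suc i) \<le> real m * 1" by simp
      also have "\<dots> \<le> real m * real (Suc k)" by (intro mult_left_mono) auto
      finally show "0 \<le> 1 - real (m - Suc i) / (real m * real (Suc k))"
        using assms by (simp add: divide_le_eq_1 del: of_nat_Suc)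
      show "1 - real (m - Suc i) / (real m * real (Suc k)) \<le>
          exp (- (real (m - Suc i) / (real m * real (Suc k))))"
        using exp_ge_add_one_self[of "- (real (m - Suc i) / (real m * real (Suc k)))"] by simp
    qed
    also have "\<dots> = exp (- ((\<Sum>i<m. real (m - Suc i)) / (real m * real (Suc k))))"
      by (simp only: exp_sum[symmetric] finite_lessThan sum_negf sum_divide_distrib)
    also have "(\<Sum>i<m. real (m - Suc i)) = (\<Sum>i<m. real i)"
      by (rule sum.nat_diff_reindex)
    \<comment> \<open>The deficits sum to m(m - 1)/2. After division by m this leaves the exponent
      \<open>?s\<close>.\<close>
    also have "\<dots> = real m * ?s"
      by (induction m) (auto simp: field_simps)
    also note cancel
    finally have "uniform_balance m (Suc k) \<le>
        exp (- (?s * harm k)) * exp (- (?s * inverse (real (Suc k))))"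
      unfolding uniform_balance_Suc[OF assms]
      by (intro order_trans[OF mult_left_mono mult_right_mono] uniform_balance_nonneg Suc) auto
    then show ?case
      by (simp only: harm_Suc distrib_left minus_add_distrib exp_add)
  qed (simp add: uniform_balance_def harm_def)
  also have "\<dots> \<le> exp (- (?s * ln (real k + 1)))"
    using ln_le_harm[of k] assms by (simp add: mult_left_mono)
  also have "\<dots> = real (Suc k) powr (- ?s)"
    by (simp add: powr_def add.commute)
  finally show ?thesis .
qed

text \<open>For these two values of \<open>m\<close> the sequence
  \<open>real k * uniform_balance m k\<close> is nondecreasing from \<open>k = 1\<close> on, so the
  terms are at least a multiple of 1/k.\<close>

lemma uniform_balance_ge:
  assumes m: "m = 2 \<or> m = 3"
  shows "uniform_balance m 1 \<le> real (Suc k) * uniform_balance m (Suc k)"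
proof (induction k)
  case (Suc k)
  define r where "r = (\<Prod>i<m. 1 - real (m - Suc i) / (real m * real (Suc (Suc k))))"
  define s where "s = real (Suc (Suc k))"
  have s: "real (Suc k) = s - 1" "s > 0" by (auto simp: s_def)
  have "r = 1 - 1 / (2 * s) \<or> r = (1 - 1 / (3 * s)) * (1 - 2 / (3 * s))"
    using m by (auto simp: r_def s_def eval_nat_numeral)
  \<comment> \<open>Monotonicity is exactly this inequality. Expanding gives s - 1/2 for m = 2, and
    s - 1 + 2/(9s) for m = 3.\<close>
  then have "s - 1 \<le> s * r"
  proof
    assume "r = (1 - 1 / (3 * s)) * (1 - 2 / (3 * s))"
    then have "s * r = s - 1 + 2 / (9 * s)"
      using s(2) by (simp add: field_simps)
    then show ?thesis using s(2) by simp
  next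
    assume "r = 1 - 1 / (2 * s)"
    then have "s * r = s - 1 / 2"
      using s(2) by (simp add: field_simps)
    then show ?thesis by simp
  qed
  then have "real (Suc k) \<le> real (Suc (Suc k)) * r"
    using s(1) by (simp add: s_def)
  then have "real (Suc k) * uniform_balance m (Suc k) \<le>
      real (Suc (Suc k)) * r * uniform_balance m (Suc k)"
    by (intro mult_right_mono uniform_balance_nonneg)
  also have "\<dots> = real (Suc (Suc k)) * uniform_balance m (Suc (Suc k))"
    using m uniform_balance_Suc[of m "Suc k"] by (auto simp: r_def mult_ac)
  finally show ?case using Suc by linarith
qed simp

text \<open>For m \<ge> 4 the exponent (m - 1)/2 is at least 3/2, giving a convergent power series
  bound; for m = 2 and m = 3 the harmonic series is a minorant up to a constant.\<close>

lemma summable_uniform_balance_iff: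
  assumes "m \<ge> 2"
  shows "summable (uniform_balance m) \<longleftrightarrow> m \<ge> 4"
proof
  assume "m \<ge> 4"
  then have m: "- ((real m - 1) / 2) < -1" "m > 0" by auto
  have "summable (\<lambda>k. real (Suc k) powr (- ((real m - 1) / 2)))"
    using m(1) summable_real_powr_iff by (subst summable_Suc_iff) blast
  then show "summable (uniform_balance m)"
    by (rule summable_comparison_test'[of _ 0])
       (use uniform_balance_nonneg uniform_balance_le[OF m(2)] in auto)
next
  assume sm: "summable (uniform_balance m)"
  show "m \<ge> 4"
  proof (rule ccontr)
    assume "\<not> m \<ge> 4"
    with assms have m: "m = 2 \<or> m = 3" by auto
    have pos: "uniform_balance m 1 > 0"
      using m by (auto simp: uniform_balance_def)
    have "summable (\<lambda>k. uniform_balance m 1 * inverse (real (Suc k)))"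
    proof (rule summable_comparison_test'[of _ 0])
      show "summable (\<lambda>k. uniform_balance m (Suc k))"
        using sm by (subst summable_Suc_iff)
      show "norm (uniform_balance m 1 * inverse (real (Suc k))) \<le> uniform_balance m (Suc k)" for k
        using uniform_balance_ge[OF m, of k] pos by (simp add: field_simps)
    qed
    then have "summable (\<lambda>k. inverse (real (Suc k)))"
      using pos by (subst (asm) summable_cmult_iff) auto
    then show False
      using summable_Suc_iff[of "\<lambda>k. inverse (real k)"] not_summable_harmonic[where 'a = real]
      by simp
  qed
qed

lemma summable_zero_weight_uniform_iff:
  fixes p :: "'m::finite \<Rightarrow> real"
  assumes "CARD('m) \<ge> 2" "\<And>j. p j = 1 / real CARD('m)"
  shows "summable (zero_weight p centred_unit) \<longleftrightarrow> CARD('m) \<ge> 4"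
proof -
  have "zero_weight p centred_unit (CARD('m) * k) = uniform_balance CARD('m) k" for k
    by (simp add: zero_weight_centred_unit card_permutations_balanced_mset assms(2)
        uniform_balance_def power_mult power_divide)
  then show ?thesis
    using summable_uniform_balance_iff[OF assms(1)]
    by (simp add: summable_zero_weight_centred_unit_iff)
qed

subsection \<open>The centred walk\<close>

lemma inj_centred_unit: "inj (centred_unit :: 'm::finite \<Rightarrow> real ^ 'm)"
  by (rule injI) (simp add: centred_unit_def axis_eq_axis)

lemma pmf_embed_pmf_finite:
  fixes p :: "'a::finite \<Rightarrow> real"
  assumes "\<And>a. 0 \<le> p a" "(\<Sum>a\<in>UNIV. p a) = 1"
  shows "pmf (embed_pmf p) a = p a"
  using assms by (intro pmf_embed_pmf) (auto simp: nn_integral_count_space_finite sum_ennreal)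

lemma lattice_walk_centred_kernel:
  fixes p :: "'m::finite \<Rightarrow> real"
  assumes "\<And>l. 0 \<le> p l" "(\<Sum>l\<in>UNIV. p l) = 1"
  shows "lattice_walk p centred_unit (centred_kernel p)"
proof
  show "pmf (centred_kernel p y) (y + centred_unit a) = p a" for y a
  proof -
    have "inj (\<lambda>l. y + centred_unit l :: real ^ 'm)"
      using inj_centred_unit by (simp add: inj_def)
    from pmf_map_inj'[OF this, of "embed_pmf p" a] show ?thesis
      by (simp add: centred_kernel_def pmf_embed_pmf_finite[OF assms])
  qed
qed (use assms inj_centred_unit in auto)

lemma countable_centred_lattice: "countable (centred_lattice :: (real ^ 'm::finite) set)"
  unfolding centred_lattice_def by (rule countable_image) simp

lemma zero_in_centred_lattice: "0 \<in> centred_lattice"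
  unfolding centred_lattice_def by (rule range_eqI[of _ _ "\<lambda>_. 0"]) simp

lemma centred_lattice_add_unit:
  fixes x :: "real ^ 'm::finite"
  assumes "x \<in> centred_lattice"
  shows "x + centred_unit l \<in> centred_lattice"
proof -
  obtain d :: "'m \<Rightarrow> int" where x: "x = (\<Sum>l\<in>UNIV. of_int (d l) *\<^sub>R centred_unit l)"
    using assms by (auto simp: centred_lattice_def)
  have "(\<Sum>j\<in>UNIV. of_int (d j + (if j = l then 1 else 0)) *\<^sub>R centred_unit j) =
      (\<Sum>j\<in>UNIV. of_int (d j) *\<^sub>R centred_unit j + (if j = l then centred_unit j else 0))"
    by (intro sum.cong) (auto simp: scaleR_add_left)
  also have "\<dots> = x + centred_unit l"
    by (simp add: sum.distrib x)
  finally show ?thesis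
    unfolding centred_lattice_def
    by (intro range_eqI[of _ _ "\<lambda>j. d j + (if j = l then 1 else 0)"]) (rule sym)
qed

text \<open>The increment of the centred walk for an arbitrary vector \<open>v\<close>, not only a
  basis vector, because the steps of the walk are basis vectors only almost surely.\<close>

definition centre :: "nat ^ 'm::finite \<Rightarrow> real ^ 'm" where
  "centre v = (\<chi> i. real (v $ i) - 1 / real CARD('m))"

lemma centre_axis: "centre (axis l 1) = centred_unit l"
  by (simp add: centre_def centred_unit_def vec_eq_iff axis_def)

text \<open>This form covers every target: if no step leads from \<open>x\<close> to
  \<open>y\<close>, the index set is empty and the sum is 0.\<close>

lemma pmf_centred_kernel:
  fixes p :: "'m::finite \<Rightarrow> real"
  assumes "\<And>l. 0 \<le> p l" "(\<Sum>l\<in>UNIV. p l) = 1"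
  shows "pmf (centred_kernel p x) y = (\<Sum>l | centre (axis l 1) = y - x. p l)"
proof -
  have "(\<lambda>l. x + centred_unit l) -` {y} = {l. centre (axis l 1) = y - x}"
    by (auto simp: centre_axis algebra_simps simp del: One_nat_def)
  then have "pmf (centred_kernel p x) y =
      measure (measure_pmf (embed_pmf p)) {l. centre (axis l 1) = y - x}"
    by (simp add: centred_kernel_def pmf_map)
  then show ?thesis
    by (simp add: measure_measure_pmf_finite pmf_embed_pmf_finite[OF assms])
qed

lemma centred_walk_Suc:
  assumes "R (Suc n) \<omega> = R n \<omega> + v"
  shows "centred_walk R (Suc n) \<omega> = centred_walk R n \<omega> + centre v"
  by (simp add: centred_walk_def centre_def vec_eq_iff assms add_divide_distrib)

text \<open>Prescribing a path up to time n prescribes its start and n independent increments.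
  Cylinder probabilities are thus products of kernel values, and the Markov identity compares the
  products for \<open>n\<close> and \<open>Suc n\<close>.\<close>

lemma (in prob_space) markov_chain_centred_walk:
  fixes p :: "'m::finite \<Rightarrow> real" and \<xi> :: "nat \<Rightarrow> 'a \<Rightarrow> nat ^ 'm"
  assumes p: "\<And>l. 0 \<le> p l" "(\<Sum>l\<in>UNIV. p l) = 1"
    and indep: "indep_vars (\<lambda>_. count_space UNIV) \<xi> UNIV"
    and \<xi>: "\<And>n l. prob {\<omega> \<in> space M. \<xi> n \<omega> = axis l 1} = p l"
    and R0: "\<And>\<omega>. \<omega> \<in> space M \<Longrightarrow> R 0 \<omega> = 0"
    and RSuc: "\<And>n \<omega>. \<omega> \<in> space M \<Longrightarrow> R (Suc n) \<omega> = R n \<omega> + \<xi> n \<omega>"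
  shows "markov_chain centred_lattice (centred_kernel p) M (centred_walk R)"
proof -
  have \<xi>_meas: "\<xi> n \<in> measurable M (count_space UNIV)" for n
    using indep by (simp add: indep_vars_def)
  have \<xi>_sets: "{\<omega> \<in> space M. \<xi> n \<omega> \<in> A} \<in> events" for n A
    using measurable_sets[OF \<xi>_meas, of A n] by (simp add: vimage_def Int_def conj_commute)

  have \<xi>_sets_eq: "{\<omega> \<in> space M. \<xi> n \<omega> = v} \<in> events" for n v
    using \<xi>_sets[of n "{v}"] by simp

  have prob_axis: "prob {\<omega> \<in> space M. \<xi> n \<omega> \<in> (\<lambda>l. axis l 1) ` L} = (\<Sum>l\<in>L. p l)" for n L
  proof -
    have "{\<omega> \<in> space M. \<xi> n \<omega> \<in> (\<lambda>l. axis l 1) ` L} =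
        (\<Union>l\<in>L. {\<omega> \<in> space M. \<xi> n \<omega> = axis l 1})"
      by auto
    then have "prob {\<omega> \<in> space M. \<xi> n \<omega> \<in> (\<lambda>l. axis l 1) ` L} =
        (\<Sum>l\<in>L. prob {\<omega> \<in> space M. \<xi> n \<omega> = axis l 1})"
      using \<xi>_sets_eq
      by (simp only:, subst finite_measure_finite_Union)
         (auto simp: disjoint_family_on_def axis_eq_axis)
    then show ?thesis by (simp only: \<xi>)
  qed
  \<comment> \<open>Taking all letters in \<open>prob_axis\<close> gives mass 1, so the prescribed
    probabilities leave only a null set for other values.\<close>
  have AE_axis: "AE \<omega> in M. \<xi> n \<omega> \<in> range (\<lambda>l. axis l 1)" for n
    using prob_axis[of n UNIV] p(2) \<xi>_sets by (subst prob_Collect_eq_1[symmetric]) auto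

  have step: "prob {\<omega> \<in> space M. centre (\<xi> n \<omega>) = y - x} = pmf (centred_kernel p x) y" for n x y
  proof -
    have "prob {\<omega> \<in> space M. centre (\<xi> n \<omega>) = y - x} =
        prob {\<omega> \<in> space M. \<xi> n \<omega> \<in> (\<lambda>l. axis l 1) ` {l. centre (axis l 1) = y - x}}"
    proof (rule measure_eq_AE)
      show "AE \<omega> in M. \<omega> \<in> {\<omega> \<in> space M. centre (\<xi> n \<omega>) = y - x} \<longleftrightarrow>
          \<omega> \<in> {\<omega> \<in> space M. \<xi> n \<omega> \<in> (\<lambda>l. axis l 1) ` {l. centre (axis l 1) = y - x}}"
        using AE_axis[of n] by eventually_elim auto
      show "{\<omega> \<in> space M. centre (\<xi> n \<omega>) = y - x} \<in> events"
        using \<xi>_sets[of n "{v. centre v = y - x}"] by simp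
    qed (rule \<xi>_sets)
    then show ?thesis
      by (simp only: prob_axis pmf_centred_kernel[OF p])
  qed

  have walk0: "centred_walk R 0 \<omega> = 0" if "\<omega> \<in> space M" for \<omega>
    using R0[OF that] by (simp add: centred_walk_def vec_eq_iff)
  have walkSuc: "centred_walk R (Suc n) \<omega> = centred_walk R n \<omega> + centre (\<xi> n \<omega>)"
    if "\<omega> \<in> space M" for n \<omega>
    by (rule centred_walk_Suc) (rule RSuc[OF that])

  have cyl: "(\<forall>i\<le>n. centred_walk R i \<omega> = y i) \<longleftrightarrow>
      y 0 = 0 \<and> (\<forall>i<n. centre (\<xi> i \<omega>) = y (Suc i) - y i)"
    if "\<omega> \<in> space M" for n \<omega> y
  proof (induction n)
    case 0
    then show ?case using walk0[OF that] by auto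
  next
    case (Suc n)
    have "(\<forall>i\<le>Suc n. centred_walk R i \<omega> = y i) \<longleftrightarrow>
        (\<forall>i\<le>n. centred_walk R i \<omega> = y i) \<and> centred_walk R (Suc n) \<omega> = y (Suc n)"
      by (auto simp: le_Suc_eq)
    also have "\<dots> \<longleftrightarrow> (\<forall>i\<le>n. centred_walk R i \<omega> = y i) \<and> centre (\<xi> n \<omega>) = y (Suc n) - y n"
      using walkSuc[OF that, of n] by (auto simp: algebra_simps)
    also have "\<dots> \<longleftrightarrow> y 0 = 0 \<and> (\<forall>i<Suc n. centre (\<xi> i \<omega>) = y (Suc i) - y i)"
      unfolding Suc by (auto simp: less_Suc_eq)
    finally show ?case .
  qed
  have prob_cyl: "prob {\<omega> \<in> space M. \<forall>i\<le>n. centred_walk R i \<omega> = y i} =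
      (if y 0 = 0 then 1 else 0) * (\<Prod>i<n. pmf (centred_kernel p (y i)) (y (Suc i)))" for n y
  \<comment> \<open>The product rule for independent variables needs a nonempty index set, so the
    path of length 0 is treated separately.\<close>
  proof (cases "n = 0")
    case True
    have "{\<omega> \<in> space M. \<forall>i\<le>n. centred_walk R i \<omega> = y i} = (if y 0 = 0 then space M else {})"
      using cyl[of _ n y] True by auto
    then show ?thesis
      using True prob_space by simp
  next
    case False
    let ?A = "\<lambda>i. {v. centre v = y (Suc i) - y i}"
    have "prob (\<Inter>i\<in>{..<n}. \<xi> i -` ?A i \<inter> space M) = (\<Prod>i<n. prob (\<xi> i -` ?A i \<inter> space M))"
      using False by (intro indep_varsD[OF indep]) auto
    also have "\<dots> = (\<Prod>i<n. pmf (centred_kernel p (y i)) (y (Suc i)))"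
      by (intro prod.cong refl)
         (simp add: vimage_def Int_def conj_commute step)
    moreover have "{\<omega> \<in> space M. \<forall>i\<le>n. centred_walk R i \<omega> = y i} =
        (if y 0 = 0 then \<Inter>i\<in>{..<n}. \<xi> i -` ?A i \<inter> space M else {})"
      using cyl[of _ n y] False by auto
    ultimately show ?thesis by simp
  qed

  have "R n \<in> measurable M (count_space UNIV)" for n
  proof (induction n)
    case 0
    have "R 0 \<in> measurable M (count_space UNIV) \<longleftrightarrow>
        (\<lambda>_. 0) \<in> measurable M (count_space (UNIV :: (nat ^ 'm) set))"
      by (rule measurable_cong) (rule R0)
    then show ?case by simp
  next
    case (Suc n)
    note [measurable] = Suc \<xi>_meas
    have "(\<lambda>\<omega>. R n \<omega> + \<xi> n \<omega>) \<in> measurable M (count_space UNIV)"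
      by measurable
    then show ?case
      by (subst measurable_cong[OF RSuc])
  qed
  then have meas: "centred_walk R n \<in> measurable M (count_space UNIV)" for n
    unfolding centred_walk_def[abs_def] by (rule measurable_compose) simp

  have AE_lattice: "AE \<omega> in M. centred_walk R n \<omega> \<in> centred_lattice" for n
  proof (induction n)
    case 0
    then show ?case
      using walk0 zero_in_centred_lattice by (intro AE_I2) simp
  next
    case (Suc n)
    from Suc AE_axis[of n] AE_space show ?case
      by eventually_elim
         (auto simp: walkSuc centre_axis simp del: One_nat_def intro: centred_lattice_add_unit)
  qed

  have "set_pmf (centred_kernel p x) \<subseteq> centred_lattice" if "x \<in> centred_lattice" for x
    using centred_lattice_add_unit[OF that] by (auto simp: centred_kernel_def)
  then show ?thesis
    unfolding markov_chain_def
    using countable_centred_lattice prob_space_axioms meas AE_lattice by (simp add: prob_cyl)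
qed

theorem mainTheorem12:
  fixes p :: "'m::finite \<Rightarrow> real"
    and M :: "'w measure"
    and \<xi> :: "nat \<Rightarrow> 'w \<Rightarrow> nat ^ 'm"
    and R :: "nat \<Rightarrow> 'w \<Rightarrow> nat ^ 'm"
  assumes "CARD('m) \<ge> 2"
    and "\<And>l. p l \<ge> 0"
    and "(\<Sum>l\<in>UNIV. p l) = 1"
    and "prob_space M"
    and "prob_space.indep_vars M (\<lambda>_. count_space UNIV) \<xi> UNIV"
    and "\<And>n l. measure M {\<omega> \<in> space M. \<xi> n \<omega> = axis l 1} = p l"
    and "\<And>\<omega>. \<omega> \<in> space M \<Longrightarrow> R 0 \<omega> = 0"
    and "\<And>n \<omega>. \<omega> \<in> space M \<Longrightarrow> R (Suc n) \<omega> = R n \<omega> + \<xi> n \<omega>"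
  shows
    "markov_chain centred_lattice (centred_kernel p) M (centred_walk R) \<and>
     ((\<exists>j. p j \<noteq> 1 / real CARD('m)) \<longrightarrow>
        transient_state (centred_kernel p) 0 \<and>
        transient_chain centred_lattice (centred_kernel p)) \<and>
     ((\<forall>j. p j = 1 / real CARD('m)) \<longrightarrow>
        (CARD('m) \<le> 3 \<longrightarrow>
           recurrent_state (centred_kernel p) 0 \<and>
           recurrent_chain centred_lattice (centred_kernel p)) \<and>
        (CARD('m) \<ge> 4 \<longrightarrow>
           transient_state (centred_kernel p) 0 \<and>
           transient_chain centred_lattice (centred_kernel p)))"
proof -
  interpret lattice_walk p centred_unit "centred_kernel p"
    using assms(2,3) by (rule lattice_walk_centred_kernel)
  have "markov_chain centred_lattice (centred_kernel p) M (centred_walk R)"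
    using assms(4,2,3,5-8) by (rule prob_space.markov_chain_centred_walk)
  \<comment> \<open>The state \<open>x\<close> is left arbitrary here and below, so the claims for
    the point 0 and for the whole chain follow together.\<close>
  moreover have "transient_state (centred_kernel p) x" if "p j \<noteq> 1 / real CARD('m)" for j x
    unfolding transient_state_iff using assms(2,3) that by (rule summable_zero_weight_nonuniform)
  moreover have "recurrent_state (centred_kernel p) x"
    if "\<forall>j. p j = 1 / real CARD('m)" "CARD('m) \<le> 3" for x
    using summable_zero_weight_uniform_iff[of p] assms(1) that by (simp add: recurrent_state_iff)
  moreover have "transient_state (centred_kernel p) x"
    if "\<forall>j. p j = 1 / real CARD('m)" "CARD('m) \<ge> 4" for x
    using summable_zero_weight_uniform_iff[of p] assms(1) that by (simp add: transient_state_iff)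
  ultimately show ?thesis
    unfolding transient_chain_def recurrent_chain_def by blast
qed

end
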